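(* Let $\alpha>0$ and $1<p<\infty$. For $k\in\mathbb{N}=\{1,2,\dots\}$ let $x_k$ be the center of the interval $[2^{k-1},2^k]$, and let $q\in L^1_{loc}(\mathbb{R})$ be defined by $$q(x)=\begin{cases}2^{k/p}, & x\in\left(x_k-\frac1{2^{k+1}},\,x_k+\frac1{2^{k+1}}\right)\text{ for some even }k\in\mathbb{N},\\ 0,&\text{otherwise.}\end{cases}$$ Let $\mu$ be the measure $\mu(A)=\int_Aq(x)\,dx$ ($A\subset\mathbb{R}$ Borel). Then $$\|q\|_{L^p(\mathbb{R})}=\infty\qquad\text{and}\qquad\|q^*_{\alpha,\mu}\|_{L^p(\mathbb{R})}<\infty .$$
   Context: For a non-negative Radon measure $\mu$ on $\mathbb{R}$ and $\alpha>0$, the Otelbaev function is $$q^*_{\alpha,\mu}(x)=\inf\left\{\tfrac1{d^2}:\ d>0,\ \mu\left(\left[x-\tfrac d2,x+\tfrac d2\right]\right)<\tfrac1{\alpha d}\right\}.$$ *)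

theory Defs
  imports "HOL-Analysis.Analysis"
begin

text \<open>For a locally finite measure the set below is nonempty, since small \<open>d\<close> are admissible,
  so the real infimum is the intended one.\<close>

definition otelbaev :: "real \<Rightarrow> real measure \<Rightarrow> real \<Rightarrow> real" where
  "otelbaev \<alpha> \<mu> x =
     Inf {1 / d\<^sup>2 | d. d > 0 \<and> emeasure \<mu> {x - d / 2 .. x + d / 2} < ennreal (1 / (\<alpha> * d))}"

text \<open>The \<open>L\<^sup>p(\<real>)\<close> norm with values in \<open>[0, \<infinity>]\<close>, for finite \<open>p > 0\<close> and measurable \<open>f\<close>.\<close>

definition Lp_norm :: "real \<Rightarrow> (real \<Rightarrow> real) \<Rightarrow> ennreal" where
  "Lp_norm p f =
     (let I = (\<integral>\<^sup>+ x. ennreal (\<bar>f x\<bar> powr p) \<partial>lborel)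
      in if I = \<infinity> then \<infinity> else ennreal (enn2real I powr (1 / p)))"

definition locally_integrable :: "(real \<Rightarrow> real) \<Rightarrow> bool" where
  "locally_integrable f \<longleftrightarrow> (\<forall>K. compact K \<longrightarrow> set_integrable lborel K f)"

definition bump :: "nat \<Rightarrow> real set" where
  "bump k = (let c = midpoint (2 ^ (k - 1)) (2 ^ k)
             in {c - 1 / 2 ^ (k + 1) <..< c + 1 / 2 ^ (k + 1)})"

lemma bump_subset:
  assumes "k \<ge> 1"
  shows "bump k \<subseteq> {2 ^ (k - 1) <..< 2 ^ k}"
proof -
  obtain j where k: "k = Suc j" using assms by (cases k) auto
  have "(1::real) \<le> 2 ^ j" by simp
  moreover have "1 / 2 ^ (k + 1) < (2::real) ^ j / 2"
    unfolding k using \<open>1 \<le> 2 ^ j\<close> mult_mono[OF \<open>1 \<le> 2 ^ j\<close> \<open>1 \<le> 2 ^ j\<close>]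
    by (simp add: field_simps)
  moreover have "midpoint (2 ^ (k - 1)) (2 ^ k) = (3::real) * 2 ^ j / 2" "(2::real) ^ k = 2 * 2 ^ j"
    by (simp_all add: k midpoint_def)
  ultimately show ?thesis
    unfolding bump_def Let_def greaterThanLessThan_subseteq_greaterThanLessThan
    by (auto simp: k)
qed

lemma bump_unique:
  assumes "k \<ge> 1" "l \<ge> 1" "x \<in> bump k" "x \<in> bump l"
  shows "k = l"
proof -
  have *: "\<not> a < b" if "a \<ge> 1" "b \<ge> 1" "x \<in> bump a" "x \<in> bump b" for a b
  proof
    assume "a < b"
    then have "(2::real) ^ a \<le> 2 ^ (b - 1)" by (intro power_increasing) auto
    moreover have "x < 2 ^ a" "2 ^ (b - 1) < x"
      using bump_subset[OF that(1)] bump_subset[OF that(2)] that(3,4) by auto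
    ultimately show False by linarith
  qed
  show ?thesis using *[of k l] *[of l k] assms by (meson linorder_neqE_nat)
qed

definition potential :: "real \<Rightarrow> real \<Rightarrow> real" where
  "potential p x =
     (if \<exists>k\<ge>1. even k \<and> x \<in> bump k
      then 2 powr (real (THE k. k \<ge> 1 \<and> even k \<and> x \<in> bump k) / p)
      else 0)"

lemma potential_bump:
  assumes "k \<ge> 1" "even k" "x \<in> bump k"
  shows "potential p x = 2 powr (real k / p)"
proof -
  have "(THE k. k \<ge> 1 \<and> even k \<and> x \<in> bump k) = k"
    using assms bump_unique by (intro the_equality) blast+
  then show ?thesis using assms by (auto simp: potential_def)
qed

lemma potential_otherwise:
  assumes "\<And>k. k \<ge> 1 \<Longrightarrow> even k \<Longrightarrow> x \<notin> bump k"
  shows "potential p x = 0"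
  using assms by (auto simp: potential_def)

end

theory Submission
  imports Defs "HOL-Real_Asymp.Real_Asymp"
begin

text \<open>The masses of the bumps form a geometric sequence \<open>m\<^sub>j = r ^ (j + 1)\<close>, \<open>r < 1\<close>. Put
  \<open>S x = (\<Sum>j. 1 / (1 / m\<^sub>j + \<bar>x - c\<^sub>j\<bar>)\<^sup>2)\<close> with \<open>c\<^sub>j\<close> the centres of the bumps. For a small
  constant \<open>\<epsilon>\<close> the length \<open>d = \<epsilon> / sqrt (S x)\<close> is admissible at \<open>x\<close>: every bump meeting the
  interval of length \<open>d\<close> around \<open>x\<close> has mass at most \<open>4 \<epsilon> / d\<close>, and the masses add up
  geometrically. Hence the Otelbaev function is at most \<open>S / \<epsilon>\<^sup>2\<close>, and \<open>S\<close> is bounded and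
  integrable because \<open>1 / (D + \<bar>x - c\<bar>)\<^sup>2\<close> has maximum \<open>1 / D\<^sup>2\<close> and integral \<open>2 / D\<close>.\<close>

section \<open>The even bumps, their masses and the measure of the potential\<close>

definition bump_ratio :: "real \<Rightarrow> real" where
  "bump_ratio p = 2 powr (2 / p - 2)"

text \<open>Only bumps with even index carry mass. The shift \<open>Suc j\<close> makes the first
  index 2, so that series run over all natural numbers.\<close>

definition even_bump :: "nat \<Rightarrow> real set" where
  "even_bump j = bump (2 * Suc j)"

definition even_center :: "nat \<Rightarrow> real" where
  "even_center j = midpoint (2 ^ (2 * Suc j - 1)) (2 ^ (2 * Suc j))"

definition majorant :: "real \<Rightarrow> real \<Rightarrow> real" where
  "majorant p x = (\<Sum>j. 1 / ((1 / bump_ratio p) ^ Suc j + \<bar>x - even_center j\<bar>)\<^sup>2)"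

lemma bump_ratio_pos: "bump_ratio p > 0"
  by (simp add: bump_ratio_def)

lemma bump_ratio_less_1:
  assumes "p > 1"
  shows "bump_ratio p < 1"
proof -
  have "2 / p < 2" using assms by (simp add: divide_less_eq)
  then show ?thesis unfolding bump_ratio_def
    by (subst powr_less_one) auto
qed

lemma bump_borel [measurable]: "bump k \<in> sets borel"
  by (simp add: bump_def Let_def)

lemma even_bump_borel [measurable]: "even_bump j \<in> sets borel"
  by (simp add: even_bump_def)

lemma emeasure_even_bump: "emeasure lborel (even_bump j) = ennreal (1 / 4 ^ Suc j)"
proof -
  have "emeasure lborel (bump k) = ennreal (1 / 2 ^ k)" for k
    unfolding bump_def Let_def by (subst emeasure_lborel_Ioo) (auto simp: field_simps)
  moreover have "(4::real) ^ Suc j = 2 ^ (2 * Suc j)"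
    by (subst power_mult) simp
  ultimately show ?thesis by (simp only: even_bump_def)
qed

text \<open>A crude radius is enough, because it is later absorbed into the reciprocal mass
  \<open>D\<close>, which is at least 1.\<close>

lemma dist_even_center:
  assumes "y \<in> even_bump j"
  shows "\<bar>y - even_center j\<bar> \<le> 1"
proof -
  have "1 / 2 ^ (2 * Suc j + 1) \<le> (1::real)"
    by (subst divide_le_eq_1_pos)
      (simp_all only: zero_less_power zero_less_numeral one_le_power one_le_numeral)
  with assms show ?thesis
    unfolding even_bump_def bump_def Let_def even_center_def greaterThanLessThan_iff
    by linarith
qed

text \<open>The bumps are pairwise disjoint, so at most one summand is nonzero at each point, and
  \<open>g 0 = 0\<close> covers the points outside all bumps. The identity for \<open>g\<close>
  serves measurability and the measure, the power \<open>p\<close> of the absolute value serves the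
  norm.\<close>

lemma potential_series:
  assumes "g 0 = 0"
  shows "ennreal (g (potential p x)) =
    (\<Sum>j. ennreal (g (2 powr (2 * real (Suc j) / p))) * indicator (even_bump j) x)"
proof (cases "\<exists>j. x \<in> even_bump j")
  case True
  then obtain j where j: "x \<in> even_bump j" by blast
  have "i = j" if "x \<in> even_bump i" for i
    using bump_unique[of "2 * Suc i" "2 * Suc j" x] that j by (simp add: even_bump_def)
  then have "(\<Sum>i. ennreal (g (2 powr (2 * real (Suc i) / p))) * indicator (even_bump i) x)
      = (\<Sum>i\<in>{j}. ennreal (g (2 powr (2 * real (Suc i) / p))) * indicator (even_bump i) x)"
    by (intro suminf_finite) (auto simp: indicator_def)
  moreover have "potential p x = 2 powr (2 * real (Suc j) / p)"
    using potential_bump[of "2 * Suc j" x p] j by (simp add: even_bump_def)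
  ultimately show ?thesis using j by simp
next
  case False
  have "potential p x = 0"
  proof (rule potential_otherwise)
    fix k :: nat assume "k \<ge> 1" "even k"
    then obtain i where "k = 2 * i" "i > 0" by (auto elim!: evenE)
    then have "k = 2 * Suc (i - 1)" by simp
    then show "x \<notin> bump k" using False unfolding even_bump_def by metis
  qed
  with False assms show ?thesis by simp
qed

lemma potential_nonneg: "potential p x \<ge> 0"
  by (simp add: potential_def)

lemma potential_measurable [measurable]: "potential p \<in> borel_measurable borel"
proof -
  \<comment> \<open>The description operator in \<open>potential\<close> hides its measurability;
    the series of indicators displays it.\<close>
  have "potential p x =
    enn2real (\<Sum>j. ennreal (2 powr (2 * real (Suc j) / p)) * indicator (even_bump j) x)" for x
    using potential_series[of "\<lambda>y. y" p x] potential_nonneg[of p x] by (metis enn2real_ennreal)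
  then have "potential p = (\<lambda>x.
    enn2real (\<Sum>j. ennreal (2 powr (2 * real (Suc j) / p)) * indicator (even_bump j) x))" ..
  then show ?thesis by simp
qed

lemma emeasure_potential:
  assumes [measurable]: "A \<in> sets borel"
  shows "emeasure (density lborel (\<lambda>x. ennreal (potential p x))) A =
    (\<Sum>j. ennreal (2 powr (2 * real (Suc j) / p)) * emeasure lborel (even_bump j \<inter> A))"
proof -
  have "emeasure (density lborel (\<lambda>x. ennreal (potential p x))) A =
      (\<integral>\<^sup>+ x. ennreal (potential p x) * indicator A x \<partial>lborel)"
    by (subst emeasure_density) auto
  also have "\<dots> = (\<integral>\<^sup>+ x. (\<Sum>j. ennreal (2 powr (2 * real (Suc j) / p))
                   * indicator (even_bump j \<inter> A) x) \<partial>lborel)"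
    by (simp add: potential_series[of "\<lambda>y. y"] indicator_inter_arith mult.assoc
        flip: ennreal_suminf_multc)
  also have "\<dots> = (\<Sum>j. \<integral>\<^sup>+ x. ennreal (2 powr (2 * real (Suc j) / p))
                   * indicator (even_bump j \<inter> A) x \<partial>lborel)"
    by (subst nn_integral_suminf) auto
  also have "\<dots> = (\<Sum>j. ennreal (2 powr (2 * real (Suc j) / p)) * emeasure lborel (even_bump j \<inter> A))"
    by (subst nn_integral_cmult_indicator) auto
  finally show ?thesis .
qed

text \<open>Height times length: bump \<open>k\<close> has height 2^(k/p) and length 2^(-k), here
  with \<open>k = 2 * Suc j\<close>.\<close>

lemma even_bump_mass:
  "2 powr (2 * real (Suc j) / p) * (1 / 4 ^ Suc j) = bump_ratio p ^ Suc j"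
proof -
  have "(4::real) ^ Suc j = 2 powr (2 * real (Suc j))"
    by (subst powr_realpow[symmetric], simp, subst powr_powr[symmetric]) simp
  moreover have "bump_ratio p ^ Suc j = 2 powr ((2 / p - 2) * real (Suc j))"
    unfolding bump_ratio_def by (subst powr_realpow[symmetric], simp, subst powr_powr) simp
  ultimately show ?thesis
    by (simp only: powr_minus_divide[symmetric] powr_add[symmetric]) (simp add: algebra_simps)
qed

text \<open>The first \<open>j\<close> bumps miss \<open>A\<close>, and each later one contributes
  at most its full mass; what remains is the tail of a geometric series. The case
  \<open>j = 0\<close> shows that the whole measure is finite.\<close>

lemma emeasure_potential_tail:
  assumes "p > 1" and A [measurable]: "A \<in> sets borel"
    and disj: "\<And>i. i < j \<Longrightarrow> even_bump i \<inter> A = {}"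
  shows "emeasure (density lborel (\<lambda>x. ennreal (potential p x))) A
    \<le> ennreal (bump_ratio p ^ Suc j / (1 - bump_ratio p))"
proof -
  let ?r = "bump_ratio p"
  let ?f = "\<lambda>i. ennreal (2 powr (2 * real (Suc i) / p)) * emeasure lborel (even_bump i \<inter> A)"
  have r: "0 < ?r" "?r < 1" using bump_ratio_pos bump_ratio_less_1[OF assms(1)] by auto
  have "(\<Sum>i. ?f i) = (\<Sum>i. ?f (i + j)) + (\<Sum>i<j. ?f i)"
    by (rule suminf_offset) simp
  also have "(\<Sum>i<j. ?f i) = 0" using disj by simp
  also have "(\<Sum>i. ?f (i + j)) \<le> (\<Sum>i. ennreal (?r ^ Suc j * ?r ^ i))"
  proof (intro suminf_le allI)
    fix i
    have "?f (i + j) \<le> ennreal (2 powr (2 * real (Suc (i + j)) / p))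
        * ennreal (1 / 4 ^ Suc (i + j))"
      unfolding emeasure_even_bump[symmetric] by (intro mult_left_mono emeasure_mono) auto
    also have "\<dots> = ennreal (?r ^ Suc (i + j))"
      by (subst ennreal_mult[symmetric]) (simp_all only: even_bump_mass, simp_all)
    finally show "?f (i + j) \<le> ennreal (?r ^ Suc j * ?r ^ i)"
      by (simp add: power_add mult_ac)
  qed auto
  also have "\<dots> = ennreal (?r ^ Suc j * (1 / (1 - ?r)))"
    using r by (intro suminf_ennreal_eq sums_mult geometric_sums) auto
  finally show ?thesis by (simp add: emeasure_potential)
qed

lemma emeasure_potential_finite:
  assumes "p > 1" and "A \<in> sets borel"
  shows "emeasure (density lborel (\<lambda>x. ennreal (potential p x))) A < \<infinity>"
  using emeasure_potential_tail[OF assms, of 0] by (auto intro: le_less_trans)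

section \<open>Local integrability and infinite norm of the potential\<close>

lemma potential_integrable:
  assumes "p > 1"
  shows "integrable lborel (potential p)"
  using emeasure_potential_finite[OF assms, of UNIV]
  by (intro integrableI_nonneg) (auto simp: potential_nonneg emeasure_density)

lemma locally_integrable_potential:
  assumes "p > 1"
  shows "locally_integrable (potential p)"
  unfolding locally_integrable_def set_integrable_def
  using potential_integrable[OF assms]
  by (intro allI impI integrable_mult_indicator) (simp_all add: borel_compact)

text \<open>The power \<open>p\<close> of the height of bump \<open>k\<close> is 2^k, which cancels
  the length 2^(-k). Each of the infinitely many even bumps thus adds exactly 1 to the
  integral.\<close>

lemma Lp_norm_potential:
  assumes "p > 1"
  shows "Lp_norm p (potential p) = \<infinity>"
proof -
  have "(\<integral>\<^sup>+ x. ennreal (\<bar>potential p x\<bar> powr p) \<partial>lborel) =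
    (\<Sum>j. ennreal (\<bar>2 powr (2 * real (Suc j) / p)\<bar> powr p) * emeasure lborel (even_bump j))"
    using assms by (subst potential_series[of "\<lambda>y. \<bar>y\<bar> powr p"])
      (simp_all add: nn_integral_suminf nn_integral_cmult_indicator)
  also have "\<dots> = (\<Sum>j. 1)"
  proof (rule suminf_cong)
    fix j
    have "\<bar>2 powr (2 * real (Suc j) / p)\<bar> powr p = 2 powr (2 * real (Suc j))"
      using assms by (simp add: powr_powr)
    also have "\<dots> = 4 ^ Suc j"
      by (subst powr_realpow[symmetric], simp, subst powr_powr[symmetric]) simp
    finally show "ennreal (\<bar>2 powr (2 * real (Suc j) / p)\<bar> powr p)
        * emeasure lborel (even_bump j) = 1"
      unfolding emeasure_even_bump by (simp flip: ennreal_mult)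
  qed
  \<comment> \<open>The sum of ones is the counting measure of the natural numbers.\<close>
  also have "(\<Sum>j::nat. (1::ennreal)) = \<infinity>"
    using nn_integral_count_space_nat[of "\<lambda>_. 1"] by simp
  finally show ?thesis by (simp add: Lp_norm_def)
qed

section \<open>The majorant: integral, summability and uniform bound\<close>

lemma nn_integral_inverse_square:
  fixes D c :: real
  assumes "D > 0"
  shows "(\<integral>\<^sup>+ x. ennreal (1 / (D + \<bar>x - c\<bar>)\<^sup>2) \<partial>lborel) \<le> ennreal (2 / D)"
proof -
  let ?h = "\<lambda>x. ennreal (1 / (D + x)\<^sup>2) * indicator {0..} x"
  have half: "(\<integral>\<^sup>+ x. ?h x \<partial>lborel) = ennreal (0 - (- 1 / (D + 0)))"
  proof (rule nn_integral_FTC_atLeast)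
    show "((\<lambda>x. - 1 / (D + x)) \<longlongrightarrow> 0) at_top" by real_asymp
    fix x :: real assume "0 \<le> x"
    with assms show "((\<lambda>x. - 1 / (D + x)) has_real_derivative 1 / (D + x)\<^sup>2) (at x)"
      by (auto intro!: derivative_eq_intros simp: power2_eq_square)
  qed auto
  \<comment> \<open>The line is split at \<open>c\<close> into two half-lines. Both contain
    \<open>c\<close>, where the right side counts twice, hence an inequality.\<close>
  have "(\<integral>\<^sup>+ x. ennreal (1 / (D + \<bar>x - c\<bar>)\<^sup>2) \<partial>lborel)
      \<le> (\<integral>\<^sup>+ x. ?h (x - c) + ?h (c - x) \<partial>lborel)"
    by (intro nn_integral_mono) (auto simp: indicator_def abs_if)
  also have "\<dots> = (\<integral>\<^sup>+ x. ?h (x - c) \<partial>lborel) + (\<integral>\<^sup>+ x. ?h (c - x) \<partial>lborel)"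
    by (rule nn_integral_add) measurable
  also have "(\<integral>\<^sup>+ x. ?h (x - c) \<partial>lborel) = (\<integral>\<^sup>+ x. ?h x \<partial>lborel)"
    using nn_integral_real_affine[of ?h 1 "- c"] by simp
  also have "(\<integral>\<^sup>+ x. ?h (c - x) \<partial>lborel) = (\<integral>\<^sup>+ x. ?h x \<partial>lborel)"
    using nn_integral_real_affine[of ?h "- 1" c] by simp
  finally show ?thesis using assms by (simp add: half flip: ennreal_plus)
qed

lemma power_inverse_bump_ratio_ge_1:
  assumes "p > 1"
  shows "(1 / bump_ratio p) ^ n \<ge> 1"
  using bump_ratio_pos[of p] bump_ratio_less_1[OF assms] by (intro one_le_power) auto

text \<open>Dropping the distance from the denominator gives a bound independent of the point, which
  yields both summability and the uniform bound of the series.\<close>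

lemma majorant_term_le:
  "1 / ((1 / bump_ratio p) ^ Suc j + \<bar>y\<bar>)\<^sup>2 \<le> (bump_ratio p ^ 2) ^ Suc j"
proof -
  have D: "0 < (1 / bump_ratio p) ^ Suc j" by (intro zero_less_power divide_pos_pos bump_ratio_pos) simp
  have "1 / ((1 / bump_ratio p) ^ Suc j + \<bar>y\<bar>)\<^sup>2 \<le> 1 / ((1 / bump_ratio p) ^ Suc j)\<^sup>2"
    using D by (intro divide_left_mono power_mono mult_pos_pos zero_less_power)
      (auto simp: bump_ratio_pos simp del: power_Suc intro: add_pos_nonneg less_imp_le)
  also have "\<dots> = (bump_ratio p ^ 2) ^ Suc j"
    by (simp only: power_divide power_one flip: power_mult) (simp add: mult.commute)
  finally show ?thesis .
qed

lemma summable_majorant: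
  assumes "p > 1"
  shows "summable (\<lambda>j. 1 / ((1 / bump_ratio p) ^ Suc j + \<bar>x - even_center j\<bar>)\<^sup>2)"
    and "summable (\<lambda>j. (bump_ratio p ^ 2) ^ Suc j)"
proof -
  have "bump_ratio p ^ 2 < 1"
    using bump_ratio_pos[of p] bump_ratio_less_1[OF assms] by (simp add: power_less_one_iff)
  then show *: "summable (\<lambda>j. (bump_ratio p ^ 2) ^ Suc j)"
    by (subst summable_Suc_iff) (simp add: summable_geometric)
  show "summable (\<lambda>j. 1 / ((1 / bump_ratio p) ^ Suc j + \<bar>x - even_center j\<bar>)\<^sup>2)"
    by (rule summable_comparison_test'[OF *, of 0]) (use majorant_term_le in auto)
qed

lemma majorant_ge:
  assumes "p > 1"
  shows "1 / ((1 / bump_ratio p) ^ Suc j + \<bar>x - even_center j\<bar>)\<^sup>2 \<le> majorant p x"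
  using sum_le_suminf[OF summable_majorant(1)[OF assms], of "{j}" x]
  by (simp add: majorant_def)

lemma majorant_pos:
  assumes "p > 1"
  shows "majorant p x > 0"
proof -
  have "0 < 1 / ((1 / bump_ratio p) ^ Suc 0 + \<bar>x - even_center 0\<bar>)\<^sup>2"
    using power_inverse_bump_ratio_ge_1[OF assms, of "Suc 0"] by auto
  also note majorant_ge[OF assms]
  finally show ?thesis .
qed

lemma majorant_le:
  assumes "p > 1"
  shows "majorant p x \<le> (\<Sum>j. (bump_ratio p ^ 2) ^ Suc j)"
  unfolding majorant_def
  by (intro suminf_le majorant_term_le summable_majorant assms)

lemma nn_integral_majorant:
  assumes "p > 1"
  shows "(\<integral>\<^sup>+ x. ennreal (majorant p x) \<partial>lborel) < \<infinity>"
proof -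
  let ?r = "bump_ratio p"
  have r: "0 < ?r" "?r < 1" using bump_ratio_pos bump_ratio_less_1[OF assms] by auto
  have "(\<integral>\<^sup>+ x. ennreal (majorant p x) \<partial>lborel) =
      (\<integral>\<^sup>+ x. (\<Sum>j. ennreal (1 / ((1 / ?r) ^ Suc j + \<bar>x - even_center j\<bar>)\<^sup>2)) \<partial>lborel)"
    unfolding majorant_def
    by (intro nn_integral_cong suminf_ennreal2[symmetric] summable_majorant assms) auto
  also have "\<dots> = (\<Sum>j. \<integral>\<^sup>+ x. ennreal (1 / ((1 / ?r) ^ Suc j + \<bar>x - even_center j\<bar>)\<^sup>2) \<partial>lborel)"
    by (rule nn_integral_suminf) measurable
  \<comment> \<open>Each integral is at most twice the mass of the corresponding bump, so these
    bounds are again geometric.\<close>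
  also have "\<dots> \<le> (\<Sum>j. ennreal (2 / (1 / ?r) ^ Suc j))"
    using r by (intro suminf_le nn_integral_inverse_square) auto
  also have "\<dots> = (\<Sum>j. ennreal (2 * ?r * ?r ^ j))"
    by (simp add: power_one_over mult_ac)
  also have "\<dots> = ennreal (2 * ?r * (1 / (1 - ?r)))"
    using r by (intro suminf_ennreal_eq sums_mult geometric_sums) auto
  finally show ?thesis by (auto intro: le_less_trans)
qed

section \<open>Admissible lengths and the pointwise bound\<close>

lemma otelbaev_le:
  assumes "d > 0" "emeasure \<mu> {x - d / 2 .. x + d / 2} < ennreal (1 / (\<alpha> * d))"
  shows "otelbaev \<alpha> \<mu> x \<le> 1 / d\<^sup>2"
  unfolding otelbaev_def using assms
  by (intro cInf_lower) (auto intro!: bdd_belowI[of _ 0])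

text \<open>This is the \<epsilon> of the overview. The bound 1 lets
  \<open>\<epsilon> * d / 2\<close> be absorbed into \<open>d / 2\<close>. The 8 is twice the factor
  in \<open>d \<le> 4 * \<epsilon> * D\<close>, which leaves room for the strict inequality in
  admissibility.\<close>

definition admissible_scale :: "real \<Rightarrow> real \<Rightarrow> real" where
  "admissible_scale \<alpha> p = min 1 ((1 - bump_ratio p) / (8 * \<alpha>))"

lemma admissible_scale_pos:
  assumes "\<alpha> > 0" "p > 1"
  shows "admissible_scale \<alpha> p > 0"
  using assms bump_ratio_less_1[OF assms(2)] by (simp add: admissible_scale_def)

lemma admissible_majorant:
  fixes \<alpha> p x :: real
  assumes "\<alpha> > 0" and p: "p > 1"
  defines "d \<equiv> admissible_scale \<alpha> p / sqrt (majorant p x)"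
  shows "emeasure (density lborel (\<lambda>x. ennreal (potential p x))) {x - d / 2 .. x + d / 2}
    < ennreal (1 / (\<alpha> * d))"
proof (cases "\<exists>j. even_bump j \<inter> {x - d / 2 .. x + d / 2} \<noteq> {}")
  case False
  have "d > 0"
    using admissible_scale_pos[OF assms(1,2)] majorant_pos[OF p] by (simp add: d_def)
  moreover have "emeasure (density lborel (\<lambda>x. ennreal (potential p x))) {x - d / 2 .. x + d / 2} = 0"
    using False by (subst emeasure_potential) auto
  ultimately show ?thesis using assms(1) by simp
next
  case True
  define \<epsilon> where "\<epsilon> = admissible_scale \<alpha> p"
  define r where "r = bump_ratio p"
  have r: "0 < r" "r < 1" using bump_ratio_pos bump_ratio_less_1[OF p] by (auto simp: r_def)
  have \<epsilon>: "\<epsilon> > 0" "\<epsilon> \<le> 1" "8 * \<alpha> * \<epsilon> \<le> 1 - r"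
  proof -
    show "\<epsilon> > 0" "\<epsilon> \<le> 1"
      using admissible_scale_pos[OF assms(1,2)] by (simp_all add: \<epsilon>_def admissible_scale_def)
    have "\<epsilon> \<le> (1 - r) / (8 * \<alpha>)" by (simp add: \<epsilon>_def r_def admissible_scale_def)
    then show "8 * \<alpha> * \<epsilon> \<le> 1 - r" using assms(1) by (simp add: pos_le_divide_eq mult.commute)
  qed
  have d: "d > 0"
    using \<epsilon> majorant_pos[OF p] by (simp add: d_def \<epsilon>_def)
  \<comment> \<open>The first bump met has the largest mass among those met, and all earlier ones
    miss the interval, as the tail estimate requires.\<close>
  define j where "j = (LEAST j. even_bump j \<inter> {x - d / 2 .. x + d / 2} \<noteq> {})"
  have j: "even_bump j \<inter> {x - d / 2 .. x + d / 2} \<noteq> {}"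
    unfolding j_def using True by (rule LeastI_ex)
  then obtain y where y: "y \<in> even_bump j" "x - d / 2 \<le> y" "y \<le> x + d / 2" by auto
  define D where "D = (1 / r) ^ Suc j"
  have D: "D \<ge> 1"
    using power_inverse_bump_ratio_ge_1[OF p] unfolding D_def r_def .
  \<comment> \<open>A single term of the series bounds the majorant from below, hence
    \<open>d\<close> from above.\<close>
  have "1 / (D + \<bar>x - even_center j\<bar>) = sqrt (1 / (D + \<bar>x - even_center j\<bar>)\<^sup>2)"
    using D by (simp add: real_sqrt_divide)
  also have "\<dots> \<le> sqrt (majorant p x)"
    using majorant_ge[OF p] unfolding D_def r_def by (intro real_sqrt_le_mono)
  finally have "d \<le> \<epsilon> / (1 / (D + \<bar>x - even_center j\<bar>))"
    unfolding d_def \<epsilon>_def[symmetric] using D \<epsilon>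
    by (intro divide_left_mono mult_pos_pos) (auto simp: majorant_pos[OF p])
  also have "\<dots> = \<epsilon> * (D + \<bar>x - even_center j\<bar>)" by simp
  \<comment> \<open>The point \<open>y\<close> lies within 1, hence within \<open>D\<close>, of the
    centre and within \<open>d / 2\<close> of \<open>x\<close>.\<close>
  also have "\<dots> \<le> \<epsilon> * (2 * D + d / 2)"
    using dist_even_center[OF y(1)] y(2,3) D \<epsilon> by (intro mult_left_mono) linarith+
  \<comment> \<open>Now \<open>d / 2\<close> can be moved to the left side, which leaves half of
    \<open>d\<close> there.\<close>
  also have "\<dots> \<le> 2 * \<epsilon> * D + d / 2"
    using \<epsilon> d by (simp add: algebra_simps mult_left_le_one_le)
  finally have "d \<le> 4 * \<epsilon> * D" by simp
  then have "d * r ^ Suc j \<le> 4 * \<epsilon>"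
    using r by (simp add: D_def power_one_over pos_le_divide_eq del: power_Suc)
  then have "\<alpha> * (d * r ^ Suc j) \<le> \<alpha> * (4 * \<epsilon>)"
    using assms(1) by (intro mult_left_mono) auto
  \<comment> \<open>In fact \<open>4 * \<alpha> * \<epsilon>\<close> is at most half of the positive
    number \<open>1 - r\<close>.\<close>
  also have "\<dots> < 1 - r" using \<epsilon> r assms(1) by simp
  finally have "r ^ Suc j / (1 - r) < 1 / (\<alpha> * d)"
    using r d assms(1) by (simp add: divide_less_eq less_divide_eq mult_ac)
  moreover have "emeasure (density lborel (\<lambda>x. ennreal (potential p x))) {x - d / 2 .. x + d / 2}
      \<le> ennreal (r ^ Suc j / (1 - r))"
    unfolding r_def by (rule emeasure_potential_tail[OF p]) (use not_less_Least j_def in auto)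
  ultimately show ?thesis
    using r by (elim le_less_trans) (simp add: ennreal_less_iff del: power_Suc)
qed

lemma otelbaev_potential_le:
  assumes "\<alpha> > 0" "p > 1"
  shows "otelbaev \<alpha> (density lborel (\<lambda>x. ennreal (potential p x))) x
    \<le> majorant p x / (admissible_scale \<alpha> p)\<^sup>2"
proof -
  have "0 < admissible_scale \<alpha> p / sqrt (majorant p x)"
    using admissible_scale_pos[OF assms] majorant_pos[OF assms(2)] by simp
  from otelbaev_le[OF this admissible_majorant[OF assms]] show ?thesis
    using majorant_pos[OF assms(2), of x] by (simp add: power_divide)
qed

section \<open>Measurability of the Otelbaev function\<close>

lemma open_small_emeasure:
  assumes sets: "sets \<mu> = sets borel" and fin: "\<And>a b. emeasure \<mu> {a..b} < \<infinity>"
  shows "open {x::real. emeasure \<mu> {x - r .. x + r} < c}"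
proof (rule openI, clarify)
  fix x assume x: "emeasure \<mu> {x - r .. x + r} < c"
  let ?A = "\<lambda>n. {x - r - 1 / real (Suc n) .. x + r + 1 / real (Suc n)}"
  \<comment> \<open>Closed intervals are decreasing limits of slightly larger ones. By continuity
    from above, some \<open>?A n\<close> still has measure below \<open>c\<close>.\<close>
  have "(\<Inter>n. ?A n) = {x - r .. x + r}"
  proof (intro equalityI subsetI)
    fix y assume "y \<in> (\<Inter>n. ?A n)"
    then have *: "x - r - 1 / real (Suc n) \<le> y" "y \<le> x + r + 1 / real (Suc n)" for n by auto
    have "x - r - 0 \<le> y"
      by (rule LIMSEQ_le_const2[OF tendsto_diff[OF tendsto_const LIMSEQ_Suc[OF lim_1_over_n]]])
        (use *(1) in auto)
    moreover have "y \<le> x + r + 0"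
      by (rule LIMSEQ_le_const[OF tendsto_add[OF tendsto_const LIMSEQ_Suc[OF lim_1_over_n]]])
        (use *(2) in auto)
    ultimately show "y \<in> {x - r .. x + r}" by simp
  next
    fix y assume y: "y \<in> {x - r .. x + r}"
    have "1 / real (Suc n) \<ge> 0" for n by simp
    with y show "y \<in> (\<Inter>n. ?A n)" by (auto intro: order_trans[of _ "x + r"] order_trans[of _ "x - r"])
  qed
  moreover have "(\<lambda>n. emeasure \<mu> (?A n)) \<longlonglongrightarrow> emeasure \<mu> (\<Inter>n. ?A n)"
  proof (rule Lim_emeasure_decseq)
    show "range ?A \<subseteq> sets \<mu>" by (auto simp: sets)
    show "decseq ?A"
    proof (intro decseq_SucI subsetI)
      fix n y assume "y \<in> ?A (Suc n)"
      moreover have "1 / real (Suc (Suc n)) \<le> 1 / real (Suc n)" by (simp add: frac_le)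
      ultimately show "y \<in> ?A n" by auto
    qed
  qed (use fin less_irrefl in metis)
  ultimately have "eventually (\<lambda>n. emeasure \<mu> (?A n) < c) sequentially"
    using x by (auto dest: order_tendstoD)
  then obtain n where n: "emeasure \<mu> (?A n) < c"
    by (auto simp: eventually_sequentially)
  \<comment> \<open>The enlargement of \<open>?A n\<close> leaves room to move the centre by less
    than \<open>1 / real (Suc n)\<close>.\<close>
  have "ball x (1 / real (Suc n)) \<subseteq> {x. emeasure \<mu> {x - r .. x + r} < c}"
  proof clarify
    fix z assume "z \<in> ball x (1 / real (Suc n))"
    then have "\<bar>x - z\<bar> < 1 / real (Suc n)" by (simp add: dist_real_def)
    then have "{z - r .. z + r} \<subseteq> ?A n"
      unfolding atLeastatMost_subset_iff by linarith
    then have "emeasure \<mu> {z - r .. z + r} \<le> emeasure \<mu> (?A n)"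
      by (intro emeasure_mono) (auto simp: sets)
    also note n
    finally show "emeasure \<mu> {z - r .. z + r} < c" .
  qed
  then show "\<exists>T>0. ball x T \<subseteq> {x. emeasure \<mu> {x - r .. x + r} < c}"
    by (intro exI[of _ "1 / real (Suc n)"]) simp
qed

text \<open>The function is upper semicontinuous. Since \<open>ne\<close> makes the infimum range
  over a nonempty set, its strict sublevel sets are unions over admissible \<open>d\<close>. Such a
  union may be uncountable, so openness of its members is the point.\<close>

lemma otelbaev_measurable:
  assumes "sets \<mu> = sets borel" and "\<And>a b. emeasure \<mu> {a..b} < \<infinity>"
    and ne: "\<And>x. \<exists>d>0. emeasure \<mu> {x - d / 2 .. x + d / 2} < ennreal (1 / (\<alpha> * d))"
  shows "otelbaev \<alpha> \<mu> \<in> borel_measurable borel"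
proof (rule borel_measurableI_less)
  fix c :: real
  have "{x. otelbaev \<alpha> \<mu> x < c} =
    (\<Union>d\<in>{d. d > 0 \<and> 1 / d\<^sup>2 < c}. {x. emeasure \<mu> {x - d / 2 .. x + d / 2} < ennreal (1 / (\<alpha> * d))})"
    unfolding otelbaev_def using ne
    by (subst cInf_less_iff) (auto intro!: bdd_belowI[of _ 0])
  also have "open \<dots>"
    by (intro open_UN ballI open_small_emeasure assms)
  finally show "{x \<in> space borel. otelbaev \<alpha> \<mu> x < c} \<in> sets borel" by simp
qed

section \<open>Finiteness of the norm of the Otelbaev function\<close>

lemma otelbaev_nonneg:
  assumes "\<exists>d>0. emeasure \<mu> {x - d / 2 .. x + d / 2} < ennreal (1 / (\<alpha> * d))"
  shows "otelbaev \<alpha> \<mu> x \<ge> 0"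
  unfolding otelbaev_def using assms by (intro cInf_greatest) auto

text \<open>Write \<open>f powr p\<close> as \<open>f powr (p - 1) * f\<close>. The first factor is
  bounded through \<open>B\<close>, using \<open>p > 1\<close>, and the second is dominated by the
  integrable \<open>C * g\<close>.\<close>

lemma Lp_norm_finite_of_majorant:
  fixes f g :: "real \<Rightarrow> real"
  assumes "p > 1" and f: "\<And>x. 0 \<le> f x" "\<And>x. f x \<le> C * g x" and g: "\<And>x. g x \<le> B"
    and "C \<ge> 0" "B \<ge> 0" and int: "(\<integral>\<^sup>+ x. ennreal (g x) \<partial>lborel) < \<infinity>"
    and [measurable]: "g \<in> borel_measurable borel"
  shows "Lp_norm p f < \<infinity>"
proof -
  have "(\<integral>\<^sup>+ x. ennreal (\<bar>f x\<bar> powr p) \<partial>lborel)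
      \<le> (\<integral>\<^sup>+ x. ennreal ((C * B) powr (p - 1) * C) * ennreal (g x) \<partial>lborel)"
  proof (rule nn_integral_mono)
    fix x
    have "f x \<le> C * B" using f(2)[of x] mult_left_mono[OF g[of x] \<open>C \<ge> 0\<close>] by linarith
    have "\<bar>f x\<bar> powr p = f x powr (p - 1) * f x"
      using f(1)[of x] powr_add[of "f x" "p - 1" 1] by simp
    also have "\<dots> \<le> (C * B) powr (p - 1) * (C * g x)"
      using f[of x] \<open>f x \<le> C * B\<close> \<open>p > 1\<close> by (intro mult_mono powr_mono2) auto
    finally show "ennreal (\<bar>f x\<bar> powr p) \<le> ennreal ((C * B) powr (p - 1) * C) * ennreal (g x)"
      using \<open>C \<ge> 0\<close> by (subst ennreal_mult'[symmetric]) (auto simp: mult.assoc intro!: ennreal_leI)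
  qed
  also have "\<dots> = ennreal ((C * B) powr (p - 1) * C) * (\<integral>\<^sup>+ x. ennreal (g x) \<partial>lborel)"
    by (rule nn_integral_cmult) measurable
  also have "\<dots> < \<infinity>" using int by (simp add: ennreal_mult_less_top)
  finally show ?thesis by (simp add: Lp_norm_def Let_def)
qed

theorem propositionA4:
  fixes \<alpha> p :: real and \<mu> :: "real measure"
  assumes "\<alpha> > 0" and "p > 1"
    and "\<mu> = density lborel (\<lambda>x. ennreal (potential p x))"
  shows "locally_integrable (potential p) \<and>
         Lp_norm p (potential p) = \<infinity> \<and>
         otelbaev \<alpha> \<mu> \<in> borel_measurable lborel \<and>
         Lp_norm p (otelbaev \<alpha> \<mu>) < \<infinity>"
proof (intro conjI)
  \<comment> \<open>Some length is admissible at every point, so the real \<open>Inf\<close> in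
    \<open>otelbaev\<close> is taken over a nonempty set.\<close>
  have ne: "\<exists>d>0. emeasure \<mu> {x - d / 2 .. x + d / 2} < ennreal (1 / (\<alpha> * d))" for x
    unfolding assms(3) using admissible_majorant[OF assms(1,2)]
    by (meson admissible_scale_pos assms(1,2) divide_pos_pos majorant_pos real_sqrt_gt_zero)
  show "locally_integrable (potential p)" "Lp_norm p (potential p) = \<infinity>"
    using assms(2) by (fact locally_integrable_potential Lp_norm_potential)+
  show "otelbaev \<alpha> \<mu> \<in> borel_measurable lborel"
    using otelbaev_measurable[OF _ _ ne] emeasure_potential_finite[OF assms(2)]
    by (simp add: assms(3))
  show "Lp_norm p (otelbaev \<alpha> \<mu>) < \<infinity>"
  proof (rule Lp_norm_finite_of_majorant[OF assms(2)])
    show "0 \<le> otelbaev \<alpha> \<mu> x" for x by (rule otelbaev_nonneg[OF ne])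
    show "otelbaev \<alpha> \<mu> x \<le> 1 / (admissible_scale \<alpha> p)\<^sup>2 * majorant p x" for x
      using otelbaev_potential_le[OF assms(1,2)] by (simp add: assms(3))
    show "majorant p x \<le> (\<Sum>j. (bump_ratio p ^ 2) ^ Suc j)" for x
      by (rule majorant_le[OF assms(2)])
    show "0 \<le> (\<Sum>j. (bump_ratio p ^ 2) ^ Suc j)"
      by (intro suminf_nonneg summable_majorant assms(2)) auto
    show "majorant p \<in> borel_measurable borel"
      unfolding majorant_def by measurable
  qed (use nn_integral_majorant[OF assms(2)] in auto)
qed

end
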